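(* Let $G$ be a word-representable graph that is not a comparability graph, and let $k \ge 2$ be an integer. Then $\mu(G^{[k]}) \le k$. Moreover, if $G$ is the union of two comparability graphs, then $\mu(G^{[k]}) = 2$.
   Context: All graphs are simple, undirected and finite. A graph is word-representable if there is a word $w$ over its vertex set such that two distinct vertices are adjacent iff their occurrences alternate in $w$. A comparability graph is a graph admitting a transitive orientation. The union of graphs $G_1,\dots,G_k$ is the graph with vertex set $\bigcup V(G_i)$ and edge set $\bigcup E(G_i)$. The multi-word-representation number $\mu(G)$ is the smallest positive integer $k$ such that $G$ is the union of $k$ word-representable graphs. The lexicographic product $G_1 \circ G_2$ has vertex set $V(G_1)\times V(G_2)$, with $(u,v)$ and $(x,y)$ adjacent iff $\{u,x\}\in E(G_1)$, or $u=x$ and $\{v,y\}\in E(G_2)$. The lexicographic power is $G^{[1]} = G$, $G^{[k]} = G^{[k-1]} \circ G$ for $k\ge 2$. *)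

theory Defs
  imports "Graph_Theory.Graph_Theory"
begin

text \<open>
  A finite simple undirected graph is a \<^locale>\<open>pair_graph\<close>: an edge between
  \<open>u\<close> and \<open>v\<close> is the symmetric pair of arcs \<open>(u, v)\<close>, \<open>(v, u)\<close>.
\<close>

definition alternate :: "'a \<Rightarrow> 'a \<Rightarrow> 'a list \<Rightarrow> bool" where
  "alternate x y w \<longleftrightarrow> distinct_adj (filter (\<lambda>z. z = x \<or> z = y) w)"

text \<open>As usual for word-representability, every vertex has to occur in the word.\<close>

definition represents :: "'a list \<Rightarrow> 'a pair_pre_digraph \<Rightarrow> bool" where
  "represents w G \<longleftrightarrow> set w = pverts G \<and>
     (\<forall>x\<in>pverts G. \<forall>y\<in>pverts G. x \<noteq> y \<longrightarrow> ((x, y) \<in> parcs G \<longleftrightarrow> alternate x y w))"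

definition word_representable :: "'a pair_pre_digraph \<Rightarrow> bool" where
  "word_representable G \<longleftrightarrow> pair_graph G \<and> (\<exists>w. represents w G)"

definition orientation :: "'a pair_pre_digraph \<Rightarrow> 'a rel \<Rightarrow> bool" where
  "orientation G D \<longleftrightarrow> D \<union> D\<inverse> = parcs G \<and> D \<inter> D\<inverse> = {}"

definition comparability_graph :: "'a pair_pre_digraph \<Rightarrow> bool" where
  "comparability_graph G \<longleftrightarrow> pair_graph G \<and> (\<exists>D. orientation G D \<and> trans D)"

definition graph_Union :: "'a pair_pre_digraph list \<Rightarrow> 'a pair_pre_digraph" where
  "graph_Union Gs = \<lparr>pverts = (\<Union>H\<in>set Gs. pverts H), parcs = (\<Union>H\<in>set Gs. parcs H)\<rparr>"

definition union_of :: "('a pair_pre_digraph \<Rightarrow> bool) \<Rightarrow> nat \<Rightarrow> 'a pair_pre_digraph \<Rightarrow> bool" where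
  "union_of P k G \<longleftrightarrow> (\<exists>Gs. length Gs = k \<and> (\<forall>H\<in>set Gs. P H) \<and> G = graph_Union Gs)"

definition mu :: "'a pair_pre_digraph \<Rightarrow> nat" where
  "mu G = (LEAST k. k \<ge> 1 \<and> union_of word_representable k G)"

definition lex_prod_graph ::
    "'a pair_pre_digraph \<Rightarrow> 'b pair_pre_digraph \<Rightarrow> ('a \<times> 'b) pair_pre_digraph" where
  "lex_prod_graph G H =
     \<lparr>pverts = pverts G \<times> pverts H,
      parcs = {((u, v), (x, y)) | u v x y.
        u \<in> pverts G \<and> x \<in> pverts G \<and> v \<in> pverts H \<and> y \<in> pverts H \<and>
        ((u, x) \<in> parcs G \<or> u = x \<and> (v, y) \<in> parcs H)}\<rparr>"

definition relabel :: "('a \<Rightarrow> 'b) \<Rightarrow> 'a pair_pre_digraph \<Rightarrow> 'b pair_pre_digraph" where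
  "relabel f G = \<lparr>pverts = f ` pverts G, parcs = map_prod f f ` parcs G\<rparr>"

text \<open>
  The nested tuples \<open>((v\<^sub>1, v\<^sub>2), \<dots>, v\<^sub>k)\<close> that are the vertices of the \<open>k\<close>-th power
  have a type depending on \<open>k\<close>; they are written as the lists \<open>[v\<^sub>1, \<dots>, v\<^sub>k]\<close>, both
  relabelings below being injective. The value at \<open>0\<close> is a convention.
\<close>

fun lex_power :: "'a pair_pre_digraph \<Rightarrow> nat \<Rightarrow> 'a list pair_pre_digraph" where
  "lex_power G 0 = \<lparr>pverts = {[]}, parcs = {}\<rparr>"
| "lex_power G (Suc 0) = relabel (\<lambda>v. [v]) G"
| "lex_power G (Suc (Suc k)) =
     relabel (\<lambda>(u, v). u @ [v]) (lex_prod_graph (lex_power G (Suc k)) G)"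

lemma pair_graph_iff:
  "pair_graph G \<longleftrightarrow> finite (pverts G) \<and> parcs G \<subseteq> pverts G \<times> pverts G \<and>
     sym (parcs G) \<and> irrefl (parcs G)"
proof
  assume "pair_graph G"
  then interpret pair_graph G .
  show "finite (pverts G) \<and> parcs G \<subseteq> pverts G \<times> pverts G \<and> sym (parcs G) \<and> irrefl (parcs G)"
    using pair_finite_verts pair_sym_arcs pair_no_loops
    by (fastforce simp: symmetric_def irrefl_def dest: in_arcsD1 in_arcsD2)
next
  assume *: "finite (pverts G) \<and> parcs G \<subseteq> pverts G \<times> pverts G \<and> sym (parcs G) \<and> irrefl (parcs G)"
  then have "finite (parcs G)"
    using finite_subset by blast
  with * show "pair_graph G"
    by unfold_locales (auto simp: symmetric_def irrefl_def)
qed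

lemma pair_graph_lex_prod_graph:
  "pair_graph G \<Longrightarrow> pair_graph H \<Longrightarrow> pair_graph (lex_prod_graph G H)"
  by (auto simp: pair_graph_iff lex_prod_graph_def sym_def irrefl_def)

lemma pair_graph_relabel:
  "pair_graph G \<Longrightarrow> inj f \<Longrightarrow> pair_graph (relabel f G)"
  by (fastforce simp: pair_graph_iff relabel_def sym_def irrefl_def inj_def)

lemma pair_graph_lex_power: "pair_graph G \<Longrightarrow> pair_graph (lex_power G k)"
proof (induction G k rule: lex_power.induct)
  case (1 G)
  show ?case by (simp add: pair_graph_iff sym_def irrefl_def)
next
  case (2 G)
  then show ?case by (simp add: pair_graph_relabel inj_def)
next
  case (3 G k)
  then show ?case by (simp add: pair_graph_relabel pair_graph_lex_prod_graph inj_def)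
qed

text \<open>The minimum defining \<^const>\<open>mu\<close> is attained for every graph.\<close>

lemma mu_exists:
  assumes "pair_graph G"
  shows "\<exists>k\<ge>1. union_of word_representable k G"
proof -
  define S where "S = insert \<lparr>pverts = {}, parcs = {}\<rparr>
    ((\<lambda>v. \<lparr>pverts = {v}, parcs = {}\<rparr>) ` pverts G \<union>
     (\<lambda>(u, v). \<lparr>pverts = {u, v}, parcs = {(u, v), (v, u)}\<rparr>) ` parcs G)"
  have G: "finite (pverts G)" "parcs G \<subseteq> pverts G \<times> pverts G" "sym (parcs G)" "irrefl (parcs G)"
    using assms by (auto simp: pair_graph_iff)
  then have "finite (parcs G)"
    using finite_subset by blast
  with G(1) have "finite S" by (simp add: S_def)
  then obtain Gs where Gs: "set Gs = S" using finite_list by blast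
  have empty: "word_representable \<lparr>pverts = {}, parcs = {}\<rparr>"
    by (auto simp: word_representable_def pair_graph_iff represents_def sym_def irrefl_def)
  have single: "word_representable \<lparr>pverts = {v}, parcs = {}\<rparr>" for v :: 'a
    by (auto simp: word_representable_def pair_graph_iff represents_def sym_def irrefl_def
        intro!: exI[of _ "[v]"])
  have edge: "word_representable \<lparr>pverts = {u, v}, parcs = {(u, v), (v, u)}\<rparr>"
    if "u \<noteq> v" for u v :: 'a
    using that
    by (auto simp: word_representable_def pair_graph_iff represents_def alternate_def sym_def
        irrefl_def intro!: exI[of _ "[u, v]"])
  have "\<forall>H\<in>set Gs. word_representable H"
    using empty single G(4) by (auto simp: Gs S_def irrefl_def intro!: edge)
  moreover have "G = graph_Union Gs"
  proof (rule pair_pre_digraph.equality)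
    show "pverts G = pverts (graph_Union Gs)"
      using G(2) by (auto simp: graph_Union_def Gs S_def)
    show "parcs G = parcs (graph_Union Gs)"
      using G(3) by (auto simp: graph_Union_def Gs S_def sym_def)
  qed simp
  moreover have "length Gs \<ge> 1"
    using Gs by (cases Gs) (auto simp: S_def)
  ultimately show ?thesis
    unfolding union_of_def by blast
qed

end

theory Submission
  imports Defs
begin

text \<open>
  Two words of the lexicographic power are adjacent iff their entries at the first position
  where they differ are adjacent in \<open>G\<close>. Sorting edges by that position writes the power as a
  union of \<open>k\<close> graphs, each a disjoint union of blow-ups of \<open>G\<close> by independent sets, and these
  are word-representable. If \<open>G\<close> is the union of comparability graphs \<open>A\<close> and \<open>B\<close>, the power
  is the union of the powers of \<open>A\<close> and \<open>B\<close>, taken on all vertices; they are transitively oriented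
  by the lexicographic orders. Finally, for \<open>k \<ge> 2\<close> the power contains a copy of \<open>G\<close>
  inside the neighbourhood of a vertex, and neighbourhoods in word-representable graphs induce
  comparability graphs.
\<close>

section \<open>Alternation through prefix counts, and neighbourhoods in represented graphs\<close>

text \<open>Both sides force the restricted word to read \<open>x\<close>, \<open>y\<close>,
  \<open>x\<close>, \<open>y\<close>, and so on. After a leading \<open>x\<close> the rest must
  satisfy the same condition with the letters exchanged, so the induction generalises over
  both.\<close>

lemma prefix_counts_iff_distinct_adj:
  assumes "x \<noteq> y"
  shows "(\<forall>n. count_list (take n w) y \<le> count_list (take n w) x \<and>
              count_list (take n w) x \<le> count_list (take n w) y + 1) \<longleftrightarrow>
    distinct_adj (filter (\<lambda>z. z = x \<or> z = y) w) \<and>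
    (filter (\<lambda>z. z = x \<or> z = y) w = [] \<or> hd (filter (\<lambda>z. z = x \<or> z = y) w) = x)"
  using assms
proof (induction w arbitrary: x y)
  case Nil
  then show ?case by simp
next
  case (Cons z w)
  have split: "(\<forall>n. P (take n (z # w))) \<longleftrightarrow> P [] \<and> (\<forall>n. P (z # take n w))" for P :: "'a list \<Rightarrow> bool"
  proof
    assume *: "\<forall>n. P (take n (z # w))"
    show "P [] \<and> (\<forall>n. P (z # take n w))"
      using *[rule_format, of 0] *[rule_format, of "Suc _"] by simp
  next
    assume *: "P [] \<and> (\<forall>n. P (z # take n w))"
    show "\<forall>n. P (take n (z # w))"
    proof
      show "P (take n (z # w))" for n using * by (cases n) simp_all
    qed
  qed
  consider "z = x" | "z = y" | "z \<noteq> x" "z \<noteq> y" by blast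
  then show ?case
  proof cases
    case 1
    let ?L = "filter (\<lambda>v. v = x \<or> v = y) w"
    have L: "filter (\<lambda>v. v = y \<or> v = x) w = ?L"
      by (rule filter_cong) auto
    have hd: "?L = [] \<or> hd ?L = x \<or> hd ?L = y"
      using hd_in_set[of ?L] by auto
    have "(\<forall>n. count_list (take n (z # w)) y \<le> count_list (take n (z # w)) x \<and>
              count_list (take n (z # w)) x \<le> count_list (take n (z # w)) y + 1) \<longleftrightarrow>
      (\<forall>n. count_list (take n w) x \<le> count_list (take n w) y \<and>
              count_list (take n w) y \<le> count_list (take n w) x + 1)"
      by (subst split) (use 1 Cons.prems in auto)
    also have "\<dots> \<longleftrightarrow> distinct_adj ?L \<and> (?L = [] \<or> hd ?L = y)"
      using Cons.IH[of y x] Cons.prems by (simp only: L) simp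
    finally show ?thesis
      using 1 hd Cons.prems by (auto simp: distinct_adj_Cons neq_Nil_conv)
  next
    case 2
    \<comment> \<open>A leading \<open>y\<close> is ahead already in the prefix of length one; the
      index is \<open>0\<close> because the head has been split off.\<close>
    then show ?thesis using Cons.prems by (subst split) (auto intro: exI[of _ 0])
  next
    case 3
    then show ?thesis using Cons.IH[OF Cons.prems] by (subst split) simp
  qed
qed

lemma alternate_commute: "alternate x y w \<longleftrightarrow> alternate y x w"
  unfolding alternate_def by (simp add: disj_commute)

text \<open>The disjuncts correspond to the letter that comes first in the restricted word; if
  neither letter occurs, both hold.\<close>

lemma alternate_iff_prefix_counts:
  assumes "x \<noteq> y"
  shows "alternate x y w \<longleftrightarrow>
    (\<forall>n. count_list (take n w) y \<le> count_list (take n w) x \<and>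
         count_list (take n w) x \<le> count_list (take n w) y + 1) \<or>
    (\<forall>n. count_list (take n w) x \<le> count_list (take n w) y \<and>
         count_list (take n w) y \<le> count_list (take n w) x + 1)"
proof -
  let ?L = "filter (\<lambda>z. z = x \<or> z = y) w"
  have L: "filter (\<lambda>z. z = y \<or> z = x) w = ?L"
    by (rule filter_cong) auto
  have "?L = [] \<or> hd ?L = x \<or> hd ?L = y"
    using hd_in_set[of ?L] by auto
  then show ?thesis
    using prefix_counts_iff_distinct_adj[OF assms, of w]
      prefix_counts_iff_distinct_adj[OF assms[symmetric], of w]
    unfolding alternate_def L by blast
qed

text \<open>
  Prefix counts are shifted by one for the letters that first occur after \<open>a\<close>. All shifted
  counts then differ from that of \<open>a\<close> by \<open>0\<close> or \<open>1\<close>, so two letters alternate iff their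
  shifted counts are comparable pointwise; pointwise comparison is transitive.
\<close>

lemma alternate_neighbours_transitive_orientation:
  assumes "V \<subseteq> set w" "a \<notin> V" "\<And>x. x \<in> V \<Longrightarrow> alternate a x w"
  obtains D where "D \<subseteq> V \<times> V" "trans D" "D \<inter> D\<inverse> = {}"
    "\<And>x y. \<lbrakk>x \<in> V; y \<in> V; x \<noteq> y\<rbrakk> \<Longrightarrow> alternate x y w \<longleftrightarrow> (x, y) \<in> D \<or> (y, x) \<in> D"
proof -
  define c where "c x n = int (count_list (take n w) x)" for x n
  have c0 [simp]: "c x 0 = 0" for x by (simp add: c_def)
  have alt: "alternate x y w \<longleftrightarrow> (\<forall>n. c y n \<le> c x n \<and> c x n \<le> c y n + 1) \<or>
      (\<forall>n. c x n \<le> c y n \<and> c y n \<le> c x n + 1)" if "x \<noteq> y" for x y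
  proof -
    have "int i \<le> int j + 1 \<longleftrightarrow> i \<le> j + 1" for i j by linarith
    then show ?thesis
      unfolding alternate_iff_prefix_counts[OF that] c_def by simp
  qed
  \<comment> \<open>For \<open>x\<close> in \<open>V\<close> the condition says, through counts
    alone, that \<open>a\<close> occurs before the first \<open>x\<close>.\<close>
  define b :: "'a \<Rightarrow> int" where "b x = (if \<forall>n. c x n \<le> c a n then 1 else 0)" for x
  have b01: "b x = 0 \<or> b x = 1" for x by (simp add: b_def)
  define d where "d x n = c x n + b x" for x n
  have near: "c a n \<le> d x n \<and> d x n \<le> c a n + 1" if xV: "x \<in> V" for x n
  proof -
    have "x \<noteq> a" using xV assms(2) by blast
    then consider "\<forall>n. c x n \<le> c a n \<and> c a n \<le> c x n + 1" | "\<forall>n. c a n \<le> c x n \<and> c x n \<le> c a n + 1"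
      using assms(3)[OF xV] alt[of a x] by blast
    then show ?thesis
    proof cases
      case 1
      then have "b x = 1" by (simp add: b_def)
      then show ?thesis using 1 by (simp add: d_def)
    next
      case 2
      show ?thesis
      proof (cases "\<forall>n. c x n \<le> c a n")
        case True
        then have "b x = 1" "c x n = c a n" using 2 by (auto simp: b_def intro: antisym)
        then show ?thesis by (simp add: d_def)
      next
        case False
        then have "b x = 0" by (simp add: b_def)
        then show ?thesis using 2 by (simp add: d_def)
      qed
    qed
  qed
  \<comment> \<open>Position \<open>0\<close> shows that the shifts agree, hence so do the plain
    counts. Stepping over an occurrence of \<open>x\<close> in \<open>w\<close> raises the count of
    \<open>x\<close> only, unless \<open>x = y\<close>.\<close>
  have inj: "x = y" if "x \<in> V" and le: "\<forall>n. d x n \<le> d y n" "\<forall>n. d y n \<le> d x n" for x y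
  proof -
    have eq: "d x n = d y n" for n using le by (simp add: antisym)
    have "b x = b y" using eq[of 0] by (simp add: d_def)
    with eq have c: "c x n = c y n" for n by (simp add: d_def)
    from that(1) assms(1) have "x \<in> set w" by blast
    then obtain i where i: "i < length w" "w ! i = x"
      by (auto simp: in_set_conv_nth)
    then show ?thesis
      using c[of i] c[of "Suc i"] by (auto simp: c_def take_Suc_conv_app_nth split: if_splits)
  qed
  define D where "D = {(x, y) \<in> V \<times> V. x \<noteq> y \<and> (\<forall>n. d y n \<le> d x n)}"
  show thesis
  proof
    show "D \<subseteq> V \<times> V" by (auto simp: D_def)
    show "D \<inter> D\<inverse> = {}"
      using inj by (auto simp: D_def)
    show "trans D"
    proof (rule transI)
      fix x y z
      assume "(x, y) \<in> D" "(y, z) \<in> D"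
      moreover from this have "x \<noteq> z"
        using inj[of x y] by (auto simp: D_def)
      ultimately show "(x, z) \<in> D"
        by (auto simp: D_def intro: order_trans)
    qed
    fix x y
    assume V: "x \<in> V" "y \<in> V" and "x \<noteq> y"
    have "(\<forall>n. d y n \<le> d x n) \<or> (\<forall>n. d x n \<le> d y n)" if "\<forall>n. c y n \<le> c x n \<and> c x n \<le> c y n + 1" for x y
    proof (cases "b y \<le> b x")
      case True
      then show ?thesis using that by (simp add: d_def add_mono)
    next
      case False
      \<comment> \<open>Here only \<open>y\<close> is shifted, so the bound
        \<open>c x n \<le> c y n + 1\<close> becomes the comparison in the opposite
        direction.\<close>
      then have "b x = 0" "b y = 1" using b01[of x] b01[of y] by auto
      then show ?thesis using that by (simp add: d_def)
    qed
    moreover have "(\<forall>n. c y n \<le> c x n \<and> c x n \<le> c y n + 1) \<or> (\<forall>n. c x n \<le> c y n \<and> c y n \<le> c x n + 1)"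
      if "\<forall>n. d y n \<le> d x n" "x \<in> V" "y \<in> V" for x y
    proof -
      \<comment> \<open>By \<open>near\<close>, both shifted counts lie between \<open>c a n\<close>
        and \<open>c a n + 1\<close>.\<close>
      have 1: "d y n \<le> d x n \<and> d x n \<le> d y n + 1" for n
        using that(1) near[OF that(2), of n] near[OF that(3), of n] by (auto intro: order_trans)
      have "b y \<le> b x" using 1[of 0] by (simp add: d_def)
      then consider "b x = b y" | "b x = 1" "b y = 0"
        using b01[of x] b01[of y] by auto
      then show ?thesis
        using 1 by cases (auto simp: d_def)
    qed
    ultimately show "alternate x y w \<longleftrightarrow> (x, y) \<in> D \<or> (y, x) \<in> D"
      unfolding alt[OF \<open>x \<noteq> y\<close>] D_def using V \<open>x \<noteq> y\<close> by blast
  qed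
qed

text \<open>The letters of the copy all alternate with \<open>a\<close> in \<open>w\<close>, so the
  copy has a transitive orientation; it is pulled back along \<open>f\<close>.\<close>

lemma comparability_graph_if_embeds_in_neighbourhood:
  assumes G: "pair_graph G" and w: "represents w H"
    and f: "inj_on f (pverts G)" "f ` pverts G \<subseteq> pverts H"
    and arcs: "\<And>u v. \<lbrakk>u \<in> pverts G; v \<in> pverts G\<rbrakk> \<Longrightarrow> (f u, f v) \<in> parcs H \<longleftrightarrow> (u, v) \<in> parcs G"
    and a: "a \<in> pverts H" "a \<notin> f ` pverts G" "\<And>v. v \<in> pverts G \<Longrightarrow> (a, f v) \<in> parcs H"
  shows "comparability_graph G"
proof -
  have "f ` pverts G \<subseteq> set w" "\<And>x. x \<in> f ` pverts G \<Longrightarrow> alternate a x w"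
    using w f(2) a unfolding represents_def by blast+
  then obtain D where D: "D \<subseteq> f ` pverts G \<times> f ` pverts G" "trans D" "D \<inter> D\<inverse> = {}"
    "\<And>x y. \<lbrakk>x \<in> f ` pverts G; y \<in> f ` pverts G; x \<noteq> y\<rbrakk>
      \<Longrightarrow> alternate x y w \<longleftrightarrow> (x, y) \<in> D \<or> (y, x) \<in> D"
    using alternate_neighbours_transitive_orientation a(2) by metis
  define E where "E = {(u, v) \<in> pverts G \<times> pverts G. (f u, f v) \<in> D}"
  have sub: "parcs G \<subseteq> pverts G \<times> pverts G" and irr: "irrefl (parcs G)"
    using G by (auto simp: pair_graph_iff)
  have "(u, v) \<in> parcs G \<longleftrightarrow> (u, v) \<in> E \<or> (v, u) \<in> E" if "u \<in> pverts G" "v \<in> pverts G" for u v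
  proof (cases "u = v")
    case True
    then show ?thesis using irr D(3) by (auto simp: irrefl_def E_def)
  next
    case False
    then have "f u \<noteq> f v" using f(1) that by (auto dest: inj_onD)
    then have "(f u, f v) \<in> parcs H \<longleftrightarrow> alternate (f u) (f v) w"
      using w f(2) that unfolding represents_def by blast
    then show ?thesis
      using D(4)[of "f u" "f v"] \<open>f u \<noteq> f v\<close> arcs that by (auto simp: E_def)
  qed
  then have "E \<union> E\<inverse> = parcs G"
    using sub by (auto simp: E_def)
  moreover have "E \<inter> E\<inverse> = {}"
    using D(3) by (auto simp: E_def)
  moreover have "trans E"
    using D(2) by (auto simp: E_def trans_def)
  ultimately show ?thesis
    using G unfolding comparability_graph_def orientation_def by blast
qed

section \<open>Words for disjoint unions of blow-ups\<close>

lemma remdups_append_absorb: "set xs \<subseteq> set ys \<Longrightarrow> remdups (xs @ ys) = remdups ys"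
  by (induction xs) auto

text \<open>\<open>remdups\<close> keeps last occurrences: an alternating restricted word ending in
  \<open>v\<close>, \<open>z\<close> is continued by \<open>v\<close>, \<open>z\<close>. This
  supplies a further round of all letters, available for separating vertices within one independent
  set.\<close>

lemma alternate_append_remdups:
  assumes "x \<in> set w" "y \<in> set w" "x \<noteq> y"
  shows "alternate x y (w @ remdups w) \<longleftrightarrow> alternate x y w"
proof -
  define u where "u = filter (\<lambda>z. z = x \<or> z = y) w"
  have set_u: "set u = {x, y}" using assms by (auto simp: u_def)
  have "distinct_adj (u @ remdups u)" if adj: "distinct_adj u"
  proof -
    obtain t1 z where t1: "u = t1 @ [z]"
      using set_u by (cases u rule: rev_cases) auto
    obtain t v where t: "t1 = t @ [v]"
      using set_u t1 assms(3) by (cases t1 rule: rev_cases) (auto simp: doubleton_eq_iff)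
    have "v \<noteq> z" using adj by (auto simp: t1 t distinct_adj_append_iff)
    moreover have "{v, z} \<subseteq> {x, y}" using set_u by (auto simp: t1 t)
    with \<open>v \<noteq> z\<close> have "{v, z} = {x, y}" by auto
    then have "remdups (t @ [v, z]) = [v, z]"
      using set_u \<open>v \<noteq> z\<close> by (subst remdups_append_absorb) (auto simp: t1 t)
    ultimately show ?thesis
      using adj by (simp add: t1 t distinct_adj_append_iff)
  qed
  then show ?thesis
    by (auto simp: alternate_def remdups_filter[symmetric] simp flip: u_def)
qed

lemma alternate_infixD: "alternate x y (u @ v @ w) \<Longrightarrow> alternate x y v"
  by (auto simp: alternate_def distinct_adj_append_iff)

lemma filter_concat_map_singletons:
  assumes "\<And>v. v \<in> set w \<Longrightarrow> filter P (L v) = (if Q v then [h v] else [])"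
  shows "filter P (concat (map L w)) = map h (filter Q w)"
  using assms by (induction w) auto

lemma filter_concat_map_Nil:
  assumes "\<And>v. v \<in> set w \<Longrightarrow> filter P (L v) = []"
  shows "filter P (concat (map L w)) = []"
  using assms by (induction w) auto

lemma filter_eq_singleton:
  assumes "distinct xs" "\<And>z. z \<in> set xs \<Longrightarrow> P z \<longleftrightarrow> z = x" "x \<in> set xs"
  shows "filter P xs = [x]"
proof -
  have "filter P xs = filter (\<lambda>z. x = z) xs"
    using assms(2) by (intro filter_cong) auto
  also have "\<dots> = [x]"
    using assms(1,3) by (induction xs) (auto simp: filter_empty_conv)
  finally show ?thesis .
qed

text \<open>
  A disjoint union, over the fibres of \<open>g\<close>, of blow-ups of \<open>G\<close> by independent sets. Each fibre
  is written by expanding the letters of a word for \<open>G\<close>, followed by a final round in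
  which the independent sets are listed in reverse.
\<close>

definition pullback_graph ::
    "'b set \<Rightarrow> ('b \<Rightarrow> 'c) \<Rightarrow> ('b \<Rightarrow> 'a) \<Rightarrow> 'a pair_pre_digraph \<Rightarrow> 'b pair_pre_digraph" where
  "pullback_graph V g f G =
     \<lparr>pverts = V, parcs = {(x, y) \<in> V \<times> V. g x = g y \<and> (f x, f y) \<in> parcs G}\<rparr>"

lemma word_representable_pullback_graph:
  assumes G: "word_representable G" and V: "finite V" "f ` V \<subseteq> pverts G"
  shows "word_representable (pullback_graph V g f G)"
proof -
  obtain w where w: "represents w G" and "pair_graph G"
    using G by (auto simp: word_representable_def)
  have set_w: "set w = pverts G"
    using w by (simp add: represents_def)
  define L where "L c v = (SOME l. distinct l \<and> set l = {x \<in> V. g x = c \<and> f x = v})" for c v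
  have "distinct (L c v) \<and> set (L c v) = {x \<in> V. g x = c \<and> f x = v}" for c v
    unfolding L_def
    by (rule someI_ex) (use V(1) finite_distinct_list[of "{x \<in> V. g x = c \<and> f x = v}"] in auto)
  then have L: "distinct (L c v)" "set (L c v) = {x \<in> V. g x = c \<and> f x = v}" for c v
    by auto
  define U where "U c = concat (map (L c) w) @ concat (map (\<lambda>v. rev (L c v)) (remdups w))" for c
  have set_U: "set (U c) = {x \<in> V. g x = c}" for c
    using V(2) by (auto simp: U_def L set_w)
  obtain cs where cs: "distinct cs" "set cs = g ` V"
    using V(1) finite_distinct_list[of "g ` V"] by auto
  define W where "W = concat (map U cs)"
  have set_W: "set W = V" by (auto simp: W_def set_U cs)
  \<comment> \<open>As \<open>cs\<close> is distinct, each fibre is written in exactly one block of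
    \<open>W\<close>.\<close>
  have W_split: "\<exists>W1 W2. W = W1 @ U (g x) @ W2 \<and> (\<forall>z. g z = g x \<longrightarrow> z \<notin> set W1 \<union> set W2)"
    if "x \<in> V" for x
  proof -
    have "g x \<in> set cs" using that cs by simp
    then obtain cs1 cs2 where "cs = cs1 @ g x # cs2" by (auto simp: in_set_conv_decomp)
    then show ?thesis using cs(1)
      by (intro exI[of _ "concat (map U cs1)"] exI[of _ "concat (map U cs2)"])
        (auto simp: W_def set_U)
  qed
  have "(x, y) \<in> parcs (pullback_graph V g f G) \<longleftrightarrow> alternate x y W"
    if xy: "x \<in> V" "y \<in> V" "x \<noteq> y" for x y
  proof -
    obtain W1 W2 where W12: "W = W1 @ U (g x) @ W2" "\<forall>z. g z = g x \<longrightarrow> z \<notin> set W1 \<union> set W2"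
      using W_split[OF xy(1)] by blast
    let ?P = "\<lambda>z. z = x \<or> z = y"
    have fx: "f x \<in> set w" "f y \<in> set w" using xy V(2) set_w by auto
    consider "g x \<noteq> g y" | "g x = g y" "f x = f y" | "g x = g y" "f x \<noteq> f y" by blast
    then show ?thesis
    proof cases
      case 1
      \<comment> \<open>With \<open>y\<close> in another fibre, the block of \<open>x\<close>
        restricts to copies of \<open>x\<close> alone, at least one from each half, so two of them
        are adjacent.\<close>
      have one: "filter ?P (L (g x) v) = (if v = f x then [x] else [])" for v
      proof (cases "v = f x")
        case True
        have "filter ?P (L (g x) v) = [x]"
          by (rule filter_eq_singleton) (use L[of "g x" v] xy 1 True in auto)
        then show ?thesis using True by simp
      next
        case False
        then show ?thesis using L[of "g x" v] 1 by (auto simp: filter_empty_conv)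
      qed
      then have one': "filter ?P (rev (L (g x) v)) = (if v = f x then [x] else [])" for v
        by (simp flip: rev_filter)
      have "filter ?P (U (g x)) = map (\<lambda>_. x) (filter (\<lambda>v. v = f x) (w @ remdups w))"
        unfolding U_def filter_append map_append
        using filter_concat_map_singletons[of w ?P "L (g x)" "\<lambda>v. v = f x" "\<lambda>_. x", OF one]
          filter_concat_map_singletons[of "remdups w" ?P "\<lambda>v. rev (L (g x) v)" "\<lambda>v. v = f x" "\<lambda>_. x", OF one']
        by simp
      then have eq: "filter ?P (U (g x)) = map (\<lambda>_. x) (filter (\<lambda>v. v = f x) w)
          @ map (\<lambda>_. x) (filter (\<lambda>v. v = f x) (remdups w))" by simp
      have "filter (\<lambda>v. v = f x) w \<noteq> []" "filter (\<lambda>v. v = f x) (remdups w) \<noteq> []"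
        using fx by (auto simp: filter_empty_conv)
      then have "\<not> alternate x y (U (g x))"
        unfolding alternate_def eq by (simp add: distinct_adj_append_iff last_map hd_map)
      then have "\<not> alternate x y W"
        using alternate_infixD W12(1) by metis
      then show ?thesis using 1 by (simp add: pullback_graph_def)
    next
      case 2
      \<comment> \<open>The last expansion of \<open>f x\<close> in the first half leaves
        \<open>l\<close>, and its expansion in the final round leaves \<open>rev l\<close> right
        behind it: the last letter of \<open>l\<close> is repeated.\<close>
      define l where "l = filter ?P (L (g x) (f x))"
      have "x \<in> set l" using xy L by (auto simp: l_def)
      then have "l \<noteq> []" by auto
      obtain w1 w2 where w12: "w = w1 @ f x # w2" "f x \<notin> set w2"
        using split_list_last[OF fx(1)] by blast
      have Nil: "filter ?P (L (g x) v) = []" if "v \<noteq> f x" for v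
        using that L[of "g x" v] 2 by (auto simp: filter_empty_conv)
      have "\<exists>r. filter ?P (concat (map (L (g x)) w)) = r @ l"
      proof -
        have "filter ?P (concat (map (L (g x)) w2)) = []"
          by (rule filter_concat_map_Nil) (rule Nil, use w12(2) in auto)
        then show ?thesis
          unfolding w12(1) by (simp add: l_def)
      qed
      moreover have "f x \<in> set (remdups w)" using fx by simp
      then obtain r1 r2 where r12: "remdups w = r1 @ f x # r2" "f x \<notin> set r1"
        using split_list_first by metis
      have "\<exists>r. filter ?P (concat (map (\<lambda>v. rev (L (g x) v)) (remdups w))) = rev l @ r"
      proof -
        have "filter ?P (concat (map (\<lambda>v. rev (L (g x) v)) r1)) = []"
          by (rule filter_concat_map_Nil) (metis Nil r12(2) rev_filter rev.simps(1))
        then show ?thesis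
          unfolding r12(1) by (simp add: l_def rev_filter)
      qed
      ultimately obtain r r' where "filter ?P (U (g x)) = (r @ l) @ rev l @ r'"
        unfolding U_def by auto
      then have "\<not> alternate x y (U (g x))"
        using \<open>l \<noteq> []\<close> by (simp add: alternate_def distinct_adj_append_iff hd_rev)
      then have "\<not> alternate x y W"
        using alternate_infixD W12(1) by metis
      moreover have "(f x, f y) \<notin> parcs G"
        using 2 \<open>pair_graph G\<close> by (auto simp: pair_graph_iff irrefl_def)
      ultimately show ?thesis by (simp add: pullback_graph_def)
    next
      case 3
      \<comment> \<open>In each expansion exactly one of \<open>x\<close>, \<open>y\<close> survives
        for the letters \<open>f x\<close>, \<open>f y\<close>, so the restriction of
        \<open>W\<close> is a renaming by \<open>h\<close> of that of
        \<open>w @ remdups w\<close>.\<close>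
      define h where "h v = (if v = f x then x else y)" for v
      let ?Q = "\<lambda>v. v = f x \<or> v = f y"
      have one: "filter ?P (L (g x) v) = (if ?Q v then [h v] else [])" for v
      proof -
        consider "v = f x" | "v = f y" | "\<not> ?Q v" by blast
        then show ?thesis
        proof cases
          assume v: "v = f x"
          have "filter ?P (L (g x) v) = [x]"
            by (rule filter_eq_singleton) (use L[of "g x" v] xy 3 v in auto)
          then show ?thesis using v by (simp add: h_def)
        next
          assume v: "v = f y"
          have "filter ?P (L (g x) v) = [y]"
            by (rule filter_eq_singleton) (use L[of "g x" v] xy 3 v in auto)
          then show ?thesis using v 3(2) by (simp add: h_def)
        next
          assume "\<not> ?Q v"
          then show ?thesis using L[of "g x" v] by (auto simp: filter_empty_conv)
        qed
      qed
      then have one': "filter ?P (rev (L (g x) v)) = (if ?Q v then [h v] else [])" for v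
        by (simp flip: rev_filter)
      have U: "filter ?P (U (g x)) = map h (filter ?Q (w @ remdups w))"
        unfolding U_def filter_append map_append
        using filter_concat_map_singletons[of w ?P "L (g x)" ?Q h, OF one]
          filter_concat_map_singletons[of "remdups w" ?P "\<lambda>v. rev (L (g x) v)" ?Q h, OF one']
        by simp
      have "filter ?P W1 = []" "filter ?P W2 = []"
        using W12(2) 3(1) by (auto simp: filter_empty_conv)
      then have "filter ?P W = map h (filter ?Q (w @ remdups w))"
        unfolding W12(1) by (simp only: filter_append U append_Nil append_Nil2)
      moreover have "inj_on h (set (filter ?Q (w @ remdups w)))"
        using xy 3 by (auto simp: inj_on_def h_def)
      ultimately have "alternate x y W \<longleftrightarrow> alternate (f x) (f y) (w @ remdups w)"
        unfolding alternate_def by (simp only: distinct_adj_map_iff)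
      also have "\<dots> \<longleftrightarrow> (f x, f y) \<in> parcs G"
        using alternate_append_remdups[OF fx 3(2)] w fx 3(2) unfolding represents_def by auto
      finally show ?thesis using xy 3 by (simp add: pullback_graph_def)
    qed
  qed
  then have "represents W (pullback_graph V g f G)"
    using set_W by (simp add: represents_def pullback_graph_def)
  moreover have "pair_graph (pullback_graph V g f G)"
    using \<open>pair_graph G\<close> V(1)
    by (auto simp: pair_graph_iff pullback_graph_def sym_def irrefl_def)
  ultimately show ?thesis
    by (auto simp: word_representable_def)
qed

section \<open>Linear extensions and the word for a comparability graph\<close>

text \<open>A minimal element of \<open>V\<close> is put first and the rest is sorted recursively;
  the result is a linear extension of \<open>r\<close> on \<open>V\<close>.\<close>

lemma acyclic_topological_sort:
  assumes "finite V" "finite r" "acyclic r"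
  shows "\<exists>l. distinct l \<and> set l = V \<and> sorted_wrt (\<lambda>x y. (y, x) \<notin> r) l"
  using assms(1)
proof (induction "card V" arbitrary: V)
  case 0
  then show ?case by (intro exI[of _ "[]"]) simp
next
  case (Suc n)
  then have "V \<noteq> {}" by auto
  with finite_acyclic_wf[OF assms(2,3)] obtain m where m: "m \<in> V" "\<And>y. (y, m) \<in> r \<Longrightarrow> y \<notin> V"
    by (meson wfE_min')
  then have "n = card (V - {m})" "finite (V - {m})"
    using Suc by auto
  then obtain l where "distinct l" "set l = V - {m}" "sorted_wrt (\<lambda>x y. (y, x) \<notin> r) l"
    using Suc.hyps(1) by blast
  then show ?case
    using m by (intro exI[of _ "m # l"]) auto
qed

lemma filter_pair_of_sorted_wrt:
  assumes "distinct l" "sorted_wrt P l" "x \<in> set l" "y \<in> set l" "x \<noteq> y" "\<not> P y x"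
  shows "filter (\<lambda>z. z = x \<or> z = y) l = [x, y]"
  using assms
proof (induction l)
  case Nil
  then show ?case by simp
next
  case (Cons v l)
  show ?case
  proof (cases "v = x \<or> v = y")
    case False
    then show ?thesis using Cons by auto
  next
    case True
    then have "v = x" using Cons.prems by auto
    moreover have "filter (\<lambda>z. z = x \<or> z = y) l = [y]"
      by (rule filter_eq_singleton) (use Cons.prems \<open>v = x\<close> in auto)
    ultimately show ?thesis by simp
  qed
qed

lemma distinct_adj_concat_replicate_pair:
  "x \<noteq> y \<Longrightarrow> distinct_adj (concat (replicate n [x, y]))"
proof (induction n)
  case 0
  then show ?case by simp
next
  case (Suc n)
  then show ?case by (cases n) auto
qed

text \<open>Two consecutive blocks must differ somewhere, and there the letter at the junction is
  repeated.\<close>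

lemma not_distinct_adj_concat_pairs:
  assumes "x \<noteq> y" "set ls \<subseteq> {[x, y], [y, x]}" "[x, y] \<in> set ls" "[y, x] \<in> set ls"
  shows "\<not> distinct_adj (concat ls)"
  using assms(2-)
proof (induction ls)
  case Nil
  then show ?case by simp
next
  case (Cons l ls)
  show ?case
  proof (cases "[x, y] \<in> set ls \<and> [y, x] \<in> set ls")
    case True
    then show ?thesis using Cons by (auto simp: distinct_adj_append_iff)
  next
    case False
    then obtain l' ls' where "ls = l' # ls'" "l' \<noteq> l" "l' \<in> {[x, y], [y, x]}" "l \<in> {[x, y], [y, x]}"
      using Cons.prems assms(1) by (cases ls) auto
    then show ?thesis by auto
  qed
qed

text \<open>The word is the concatenation of all linear extensions of a transitive orientation.\<close>

lemma word_representable_if_comparability_graph: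
  assumes "comparability_graph G"
  shows "word_representable G"
proof -
  obtain D where G: "pair_graph G" and D: "D \<union> D\<inverse> = parcs G" "D \<inter> D\<inverse> = {}" "trans D"
    using assms by (auto simp: comparability_graph_def orientation_def)
  let ?V = "pverts G"
  have V: "finite ?V" "D \<subseteq> ?V \<times> ?V" using G D(1) by (auto simp: pair_graph_iff)
  then have "finite D" using finite_subset by blast
  have "acyclic D" using D(2,3) by (auto simp: acyclic_def)
  define S where "S = {l. distinct l \<and> set l = ?V \<and> sorted_wrt (\<lambda>x y. (y, x) \<notin> D) l}"
  have "finite {l. set l \<subseteq> ?V \<and> distinct l}"
    using V(1) by (rule finite_subset_distinct)
  then have "finite S" by (rule finite_subset[rotated]) (auto simp: S_def)
  then obtain ls where ls: "set ls = S" using finite_list by blast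
  define w where "w = concat ls"
  have ext: "\<exists>l\<in>S. filter (\<lambda>z. z = x \<or> z = y) l = [x, y]"
    if "x \<in> ?V" "y \<in> ?V" "x \<noteq> y" "(y, x) \<notin> D" for x y
  proof -
    \<comment> \<open>A cycle through the new arc would need a path from \<open>y\<close> to
      \<open>x\<close>, which by transitivity is a single arc of \<open>D\<close>.\<close>
    have "acyclic (insert (x, y) D)"
      using \<open>acyclic D\<close> that D(3) by (auto simp: rtrancl_eq_or_trancl)
    then obtain l where l: "distinct l" "set l = ?V" "sorted_wrt (\<lambda>u v. (v, u) \<notin> insert (x, y) D) l"
      using acyclic_topological_sort[OF V(1)] \<open>finite D\<close> by blast
    have "filter (\<lambda>z. z = x \<or> z = y) l = [x, y]"
      by (rule filter_pair_of_sorted_wrt[OF l(1,3)]) (use l(2) that in auto)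
    moreover have "l \<in> S"
      using l sorted_wrt_mono_rel[OF _ l(3)] by (auto simp: S_def)
    ultimately show ?thesis by blast
  qed
  \<comment> \<open>Some linear extension must exist, for otherwise \<open>w\<close> would be empty
    and miss the vertices.\<close>
  obtain l0 where "l0 \<in> S"
    using acyclic_topological_sort[OF V(1) \<open>finite D\<close> \<open>acyclic D\<close>] by (auto simp: S_def)
  then have set_w: "set w = ?V"
    by (auto simp: w_def ls S_def)
  have adj: "alternate x y w" if "(x, y) \<in> D" for x y
  proof -
    have "x \<noteq> y" using that D(2) by auto
    have "filter (\<lambda>z. z = x \<or> z = y) l = [x, y]" if "l \<in> S" for l
      by (rule filter_pair_of_sorted_wrt[of l "\<lambda>x y. (y, x) \<notin> D"])
        (use that \<open>(x, y) \<in> D\<close> V(2) \<open>x \<noteq> y\<close> in \<open>auto simp: S_def\<close>)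
    then have "map (filter (\<lambda>z. z = x \<or> z = y)) ls = replicate (length ls) [x, y]"
      using ls by (intro nth_equalityI) auto
    then show ?thesis
      using \<open>x \<noteq> y\<close> by (simp add: alternate_def w_def filter_concat distinct_adj_concat_replicate_pair)
  qed
  have "(x, y) \<in> parcs G \<longleftrightarrow> alternate x y w" if xy: "x \<in> ?V" "y \<in> ?V" "x \<noteq> y" for x y
  proof
    assume "(x, y) \<in> parcs G"
    then have "(x, y) \<in> D \<or> (y, x) \<in> D" using D(1) by auto
    then show "alternate x y w"
      using adj[of x y] adj[of y x] alternate_commute[of x y w] by blast
  next
    assume alt: "alternate x y w"
    show "(x, y) \<in> parcs G"
    proof (rule ccontr)
      assume "(x, y) \<notin> parcs G"
      then have nD: "(x, y) \<notin> D" "(y, x) \<notin> D" using D(1) by auto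
      \<comment> \<open>Incomparable vertices occur in both orders among the linear extensions,
        which breaks alternation in \<open>w\<close>.\<close>
      let ?F = "filter (\<lambda>z. z = x \<or> z = y)"
      have "?F = filter (\<lambda>z. z = y \<or> z = x)" by (auto simp: disj_commute)
      then have "[x, y] \<in> set (map ?F ls)" "[y, x] \<in> set (map ?F ls)"
        using ext[OF xy nD(2)] ext[OF xy(2,1) xy(3)[symmetric] nD(1)] ls by force+
      moreover have "set (map ?F ls) \<subseteq> {[x, y], [y, x]}"
      proof -
        have "?F l \<in> {[x, y], [y, x]}" if "l \<in> S" for l
        proof -
          have "distinct (?F l)" "set (?F l) = {x, y}"
            using that xy by (auto simp: S_def)
          then have "length (?F l) = 2" using xy(3) distinct_card[of "?F l"] by simp
          then obtain u v where "?F l = [u, v]"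
            by (auto simp: length_Suc_conv numeral_2_eq_2)
          then show ?thesis
            using \<open>set (?F l) = {x, y}\<close> by (auto simp: doubleton_eq_iff)
        qed
        then show ?thesis using ls by auto
      qed
      ultimately show False
        using not_distinct_adj_concat_pairs[OF xy(3)] alt
        by (simp add: alternate_def w_def filter_concat)
    qed
  qed
  then have "represents w G" using set_w by (simp add: represents_def)
  then show ?thesis using G by (auto simp: word_representable_def)
qed

section \<open>Lexicographic powers as graphs on words, and their decompositions\<close>

text \<open>\<open>lex\<close> recurses at the head while \<open>lex_power\<close> appends at the
  end; this is the recursion of \<open>lex\<close> in the latter direction.\<close>

lemma snoc_in_lex:
  assumes "length xs = length ys"
  shows "(xs @ [x], ys @ [y]) \<in> lex r \<longleftrightarrow> (xs, ys) \<in> lex r \<or> xs = ys \<and> (x, y) \<in> r"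
  using assms by (induction xs ys rule: list_induct2) auto

lemma lex_iff_nth:
  assumes "length xs = length ys"
  shows "(xs, ys) \<in> lex r \<longleftrightarrow> (\<exists>i<length xs. take i xs = take i ys \<and> (xs ! i, ys ! i) \<in> r)"
  using assms
proof (induction xs ys rule: list_induct2)
  case Nil
  then show ?case by simp
next
  case (Cons x xs y ys)
  then show ?case by (auto simp: Ex_less_Suc2)
qed

lemma lex_Un: "lex (r \<union> s) = lex r \<union> lex s"
  by (auto simp: lex_conv) blast+

lemma lex_converse: "lex (r\<inverse>) = (lex r)\<inverse>"
  by (fastforce simp: lex_conv)

lemma lex_irreflexive: "irrefl r \<Longrightarrow> (xs, xs) \<notin> lex r"
  by (induction xs) (auto simp: irrefl_def)

definition words :: "'a set \<Rightarrow> nat \<Rightarrow> 'a list set" where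
  "words V k = {xs. set xs \<subseteq> V \<and> length xs = k}"

lemma finite_words: "finite V \<Longrightarrow> finite (words V k)"
  unfolding words_def by (rule finite_lists_length_eq)

text \<open>\<open>V\<close> is independent of \<open>r\<close>, so that summands of a graph can all
  be placed on the words over its full vertex set.\<close>

definition lex_graph :: "'a set \<Rightarrow> 'a rel \<Rightarrow> nat \<Rightarrow> 'a list pair_pre_digraph" where
  "lex_graph V r k = \<lparr>pverts = words V k, parcs = lex r \<inter> words V k \<times> words V k\<rparr>"

lemma lex_power_eq_lex_graph:
  assumes "parcs G \<subseteq> pverts G \<times> pverts G"
  shows "lex_power G k = lex_graph (pverts G) (parcs G) k"
  using assms
proof (induction G k rule: lex_power.induct)
  case (1 G)
  then show ?case by (auto simp: lex_graph_def words_def)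
next
  case (2 G)
  then show ?case
    by (auto simp: lex_graph_def words_def relabel_def length_Suc_conv image_iff)
next
  case (3 G k)
  let ?S = "words (pverts G) (Suc k)" and ?S' = "words (pverts G) (Suc (Suc k))"
  have IH: "lex_power G (Suc k) = lex_graph (pverts G) (parcs G) (Suc k)"
    using 3 by blast
  have snoc: "xs @ [x] \<in> ?S' \<longleftrightarrow> xs \<in> ?S \<and> x \<in> pverts G" for xs x
    by (auto simp: words_def)
  have dest: "\<exists>ys y. xs = ys @ [y] \<and> ys \<in> ?S \<and> y \<in> pverts G" if "xs \<in> ?S'" for xs
    using that by (cases xs rule: rev_cases) (auto simp: words_def)
  have len: "length xs = length ys" if "xs \<in> ?S" "ys \<in> ?S" for xs ys
    using that by (auto simp: words_def)
  show ?case
  proof (rule pair_pre_digraph.equality)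
    show "pverts (lex_power G (Suc (Suc k))) = pverts (lex_graph (pverts G) (parcs G) (Suc (Suc k)))"
      by (auto simp: IH relabel_def lex_prod_graph_def lex_graph_def snoc dest!: dest)
    have arcs: "(p, q) \<in> parcs (lex_power G (Suc (Suc k))) \<longleftrightarrow>
        (\<exists>xs x ys y. p = xs @ [x] \<and> q = ys @ [y] \<and> xs \<in> ?S \<and> ys \<in> ?S \<and> x \<in> pverts G \<and> y \<in> pverts G \<and>
          ((xs, ys) \<in> lex (parcs G) \<or> xs = ys \<and> (x, y) \<in> parcs G))" for p q
      by (auto simp: IH relabel_def lex_prod_graph_def lex_graph_def image_iff Bex_def)
    have "(p, q) \<in> parcs (lex_power G (Suc (Suc k))) \<longleftrightarrow>
        (p, q) \<in> parcs (lex_graph (pverts G) (parcs G) (Suc (Suc k)))" for p q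
      unfolding arcs by (auto simp: lex_graph_def snoc snoc_in_lex[OF len] dest!: dest)
    then show "parcs (lex_power G (Suc (Suc k))) = parcs (lex_graph (pverts G) (parcs G) (Suc (Suc k)))"
      by auto
  qed simp
qed

lemma pair_graph_lex_graph:
  assumes "finite V" "sym r" "irrefl r"
  shows "pair_graph (lex_graph V r k)"
proof -
  have "sym (lex r)"
    using assms(2) lex_converse[of r] by (simp add: sym_conv_converse_eq)
  then show ?thesis
    using assms finite_words lex_irreflexive[OF assms(3)]
    by (auto simp: pair_graph_iff lex_graph_def sym_def irrefl_def)
qed

text \<open>\<open>lex\<close> commutes with unions and converses and preserves transitivity, so
  \<open>lex D\<close> orients the graph.\<close>

lemma comparability_graph_lex_graph:
  assumes "finite V" "comparability_graph A"
  shows "comparability_graph (lex_graph V (parcs A) k)"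
proof -
  obtain D where A: "pair_graph A" and D: "D \<union> D\<inverse> = parcs A" "D \<inter> D\<inverse> = {}" "trans D"
    using assms(2) by (auto simp: comparability_graph_def orientation_def)
  have "irrefl D" using D(2) by (auto simp: irrefl_def)
  have trans: "trans (lex D)" using D(3) by (rule lex_transI)
  have lex: "lex (parcs A) = lex D \<union> (lex D)\<inverse>"
    by (simp add: lex_Un lex_converse flip: D(1))
  define E where "E = lex D \<inter> words V k \<times> words V k"
  have "E \<union> E\<inverse> = parcs (lex_graph V (parcs A) k)"
    by (auto simp: E_def lex_graph_def lex)
  \<comment> \<open>Opposite arcs would compose by transitivity to a loop of
    \<open>lex D\<close>.\<close>
  moreover have "E \<inter> E\<inverse> = {}"
    using lex_irreflexive[OF \<open>irrefl D\<close>] trans by (auto simp: E_def dest: transD)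
  moreover have "trans E"
    using trans unfolding E_def trans_def by blast
  moreover have "pair_graph (lex_graph V (parcs A) k)"
    using A assms(1) by (intro pair_graph_lex_graph) (auto simp: pair_graph_iff)
  ultimately show ?thesis
    unfolding comparability_graph_def orientation_def by blast
qed

text \<open>The \<open>i\<close>-th summand consists of the edges between words that first differ at position \<open>i\<close>.\<close>

lemma union_of_word_representable_lex_graph:
  assumes "word_representable G" "k \<ge> 1"
  shows "union_of word_representable k (lex_graph (pverts G) (parcs G) k)"
proof -
  let ?V = "words (pverts G) k"
  \<comment> \<open>The fibre fixes the common prefix before position \<open>i\<close>; entries
    after \<open>i\<close> are free, so words sharing prefix and entry \<open>i\<close> form an
    independent set.\<close>
  define H where "H i = pullback_graph ?V (take i) (\<lambda>xs. xs ! i) G" for i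
  have "finite (pverts G)"
    using assms(1) by (simp add: word_representable_def pair_graph_iff)
  then have "word_representable (H i)" if "i < k" for i
    unfolding H_def using that assms(1)
    by (intro word_representable_pullback_graph finite_words) (auto simp: words_def)
  moreover have "lex_graph (pverts G) (parcs G) k = graph_Union (map H [0..<k])"
  proof (rule pair_pre_digraph.equality)
    show "pverts (lex_graph (pverts G) (parcs G) k) = pverts (graph_Union (map H [0..<k]))"
      using assms(2) by (auto simp: lex_graph_def graph_Union_def H_def pullback_graph_def)
    have "(xs, ys) \<in> lex (parcs G) \<longleftrightarrow> (\<exists>i<k. take i xs = take i ys \<and> (xs ! i, ys ! i) \<in> parcs G)"
      if "xs \<in> ?V" "ys \<in> ?V" for xs ys
      using that lex_iff_nth[of xs ys] by (simp add: words_def)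
    then show "parcs (lex_graph (pverts G) (parcs G) k) = parcs (graph_Union (map H [0..<k]))"
      by (auto simp: lex_graph_def graph_Union_def H_def pullback_graph_def Bex_def)
  qed simp
  ultimately show ?thesis
    unfolding union_of_def by (intro exI[of _ "map H [0..<k]"]) auto
qed

text \<open>\<open>lex\<close> distributes over the union of the arc sets. At least one summand is
  required, since an empty union has no vertices.\<close>

lemma union_of_comparability_graph_lex_graph:
  assumes "finite (pverts G)" "union_of comparability_graph n G" "n \<ge> 1"
  shows "union_of comparability_graph n (lex_graph (pverts G) (parcs G) k)"
proof -
  obtain Gs where Gs: "length Gs = n" "\<forall>A\<in>set Gs. comparability_graph A" "G = graph_Union Gs"
    using assms(2) by (auto simp: union_of_def)
  let ?H = "\<lambda>A. lex_graph (pverts G) (parcs A) k"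
  have "Gs \<noteq> []" using Gs(1) assms(3) by auto
  moreover have "lex (\<Union>A\<in>set Gs. parcs A) = (\<Union>A\<in>set Gs. lex (parcs A))"
    by (auto simp: lex_conv) blast+
  moreover have "parcs G = (\<Union>A\<in>set Gs. parcs A)" by (simp add: Gs(3) graph_Union_def)
  ultimately have "lex_graph (pverts G) (parcs G) k = graph_Union (map ?H Gs)"
    by (auto simp: lex_graph_def graph_Union_def)
  then show ?thesis
    unfolding union_of_def using Gs assms(1)
    by (intro exI[of _ "map ?H Gs"]) (auto intro: comparability_graph_lex_graph)
qed

text \<open>
  For an edge \<open>uv\<close> of \<open>G\<close>, the copy of \<open>G\<close> with first coordinate \<open>u\<close> lies in the
  neighbourhood of any vertex with first coordinate \<open>v\<close>.
\<close>

lemma comparability_graph_if_word_representable_lex_graph: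
  assumes G: "pair_graph G" and "k \<ge> 2"
    and rep: "word_representable (lex_graph (pverts G) (parcs G) k)"
  shows "comparability_graph G"
proof (cases "parcs G = {}")
  case True
  then show ?thesis
    using G by (auto simp: comparability_graph_def orientation_def intro: exI[of _ "{}"])
next
  case False
  then obtain u v where uv: "(u, v) \<in> parcs G" by auto
  have P: "parcs G \<subseteq> pverts G \<times> pverts G" "sym (parcs G)" "irrefl (parcs G)"
    using G by (auto simp: pair_graph_iff)
  then have V: "u \<in> pverts G" "v \<in> pverts G" "u \<noteq> v" "(v, u) \<in> parcs G" "(u, u) \<notin> parcs G"
    using uv by (auto simp: irrefl_def dest: symD)
  obtain w where w: "represents w (lex_graph (pverts G) (parcs G) k)"
    using rep by (auto simp: word_representable_def)
  \<comment> \<open>The copy varies the second coordinate, which exists as \<open>k \<ge> 2\<close>;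
    the padding with \<open>u\<close> is constant and there are no loops, so only that coordinate
    decides adjacency.\<close>
  define f where "f x = u # x # replicate (k - 2) u" for x
  define a where "a = v # v # replicate (k - 2) u"
  have f: "f x \<in> words (pverts G) k" if "x \<in> pverts G" for x
    using that V assms(2) by (auto simp: f_def words_def)
  have a: "a \<in> words (pverts G) k"
    using V assms(2) by (auto simp: a_def words_def)
  show ?thesis
  proof (rule comparability_graph_if_embeds_in_neighbourhood[OF G w, of f a])
    show "inj_on f (pverts G)" by (auto simp: inj_on_def f_def)
    show "f ` pverts G \<subseteq> pverts (lex_graph (pverts G) (parcs G) k)"
      using f by (auto simp: lex_graph_def)
    show "a \<in> pverts (lex_graph (pverts G) (parcs G) k)"
      using a by (simp add: lex_graph_def)
    show "a \<notin> f ` pverts G" using V by (auto simp: a_def f_def)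
    show "(a, f x) \<in> parcs (lex_graph (pverts G) (parcs G) k)" if "x \<in> pverts G" for x
      using a f[OF that] V by (auto simp: lex_graph_def a_def f_def)
    show "(f x, f y) \<in> parcs (lex_graph (pverts G) (parcs G) k) \<longleftrightarrow> (x, y) \<in> parcs G"
      if "x \<in> pverts G" "y \<in> pverts G" for x y
      using f[OF that(1)] f[OF that(2)] V lex_irreflexive[OF P(3)]
      by (auto simp: lex_graph_def f_def)
  qed
qed

section \<open>Bounds on \<open>mu\<close>\<close>

lemma union_of_1_iff: "union_of P 1 G \<longleftrightarrow> P G"
proof -
  have "graph_Union [H] = H" for H :: "'a pair_pre_digraph"
    by (simp add: graph_Union_def)
  then show ?thesis
    by (auto simp: union_of_def length_Suc_conv intro!: exI[of _ "[G]"])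
qed

lemma mu_le: "\<lbrakk>k \<ge> 1; union_of word_representable k G\<rbrakk> \<Longrightarrow> mu G \<le> k"
  unfolding mu_def by (rule Least_le) blast

lemma mu_attained:
  assumes "pair_graph G"
  shows "mu G \<ge> 1 \<and> union_of word_representable (mu G) G"
  unfolding mu_def by (rule LeastI_ex) (use mu_exists[OF assms] in blast)

theorem theorem10:
  fixes G :: "'a pair_pre_digraph" and k :: nat
  assumes "word_representable G"
    and "\<not> comparability_graph G"
    and "k \<ge> 2"
  shows "mu (lex_power G k) \<le> k \<and>
    (union_of comparability_graph 2 G \<longrightarrow> mu (lex_power G k) = 2)"
proof -
  have G: "pair_graph G" using assms(1) by (simp add: word_representable_def)
  then have pow: "lex_power G k = lex_graph (pverts G) (parcs G) k"
    by (intro lex_power_eq_lex_graph) (simp add: pair_graph_iff)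
  have "mu (lex_power G k) \<le> k"
    unfolding pow using assms(1,3) by (intro mu_le union_of_word_representable_lex_graph) auto
  moreover have "mu (lex_power G k) = 2" if "union_of comparability_graph 2 G"
  proof (rule antisym)
    have "union_of comparability_graph 2 (lex_power G k)"
      unfolding pow using that G
      by (intro union_of_comparability_graph_lex_graph) (auto simp: pair_graph_iff)
    then have "union_of word_representable 2 (lex_power G k)"
      unfolding union_of_def using word_representable_if_comparability_graph by blast
    then show "mu (lex_power G k) \<le> 2" by (intro mu_le) auto
    have "\<not> word_representable (lex_power G k)"
      unfolding pow using comparability_graph_if_word_representable_lex_graph G assms(2,3) by blast
    \<comment> \<open>The minimum is attained, so the value \<open>1\<close> would make the power
      itself word-representable.\<close>
    then have "mu (lex_power G k) \<noteq> 1"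
      using mu_attained[OF pair_graph_lex_power[OF G]] union_of_1_iff by metis
    then show "2 \<le> mu (lex_power G k)"
      using mu_attained[OF pair_graph_lex_power[OF G], of k] by linarith
  qed
  ultimately show ?thesis by blast
qed

end
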